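(* Let $p_1, p_2 \in \mathbb{N}$, set $p = p_1 + p_2$, let $\alpha$ be a real number with $2\alpha \in \mathbb{N} \cup (p-1, \infty)$, and let $\Sigma$ be a real symmetric positive semidefinite matrix of size $p \times p$. Let $(X_1, X_2)$ be a random pair with the multivariate trace-Wishart distribution $\mathrm{TW}_{p_1,p_2}(\alpha, \Sigma)$. Then, for all reals $q_1, q_2 \in [0,1]$, \[ \mathbb{E}(X_1^{q_1} X_2^{q_2}) \geq \mathbb{E}(X_1^{q_1}) \, \mathbb{E}(X_2^{q_2}). \]
   Context: $\mathbb{N} = \{1, 2, \ldots\}$; $|\cdot|$ denotes the determinant and $\mathrm{I}_m$ the $m \times m$ identity matrix. Multivariate trace-Wishart distribution (bivariate case): for $p_1, p_2 \in \mathbb{N}$, $p = p_1 + p_2$, $2\alpha \in \mathbb{N} \cup (p-1,\infty)$ and $\Sigma$ a $p \times p$ symmetric positive semidefinite matrix, a random pair $(X_1, X_2)$ is said to follow $\mathrm{TW}_{p_1,p_2}(\alpha,\Sigma)$ if and only if, for all $(t_1, t_2) \in [0,\infty)^2$, \[ \mathbb{E}\big(e^{-t_1 X_1 - t_2 X_2}\big) = \big| \mathrm{I}_p + \mathrm{diag}(t_1 \mathrm{I}_{p_1}, t_2 \mathrm{I}_{p_2}) \, \Sigma \big|^{-\alpha}, \] where $\mathrm{diag}(\cdot)$ is the block-diagonal matrix. Equivalently, $(X_1, X_2)$ has the same distribution as $(\mathrm{tr}(W_{11}), \mathrm{tr}(W_{22}))$, where $W \sim \mathrm{Wishart}_p(2\alpha,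 \Sigma/2)$ has diagonal blocks $W_{11}$, $W_{22}$ of sizes $p_1 \times p_1$ and $p_2 \times p_2$; in particular $X_1, X_2$ are almost surely nonnegative. The convention $0^0 = 1$ is used. *)

theory Defs
  imports
    "HOL-Probability.Probability"
    "Jordan_Normal_Form.Determinant"
begin

hide_const (open) Determinants.det

definition sym_pos_semidef :: "nat \<Rightarrow> real mat \<Rightarrow> bool" where
  "sym_pos_semidef n A \<longleftrightarrow> A \<in> carrier_mat n n \<and> transpose_mat A = A \<and>
     (\<forall>v\<in>carrier_vec n. 0 \<le> scalar_prod v (A *\<^sub>v v))"

(* The base of the power is positive (it is 1 when t1 = t2 = 0, and det (1 + T S) > 0 for S
   positive semidefinite and T = diag(t1 I, t2 I) with t1, t2 >= 0), so powr is the ordinary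
   real power.  Nonnegativity of X1 and X2 is a consequence of the transform identity. *)
definition trace_Wishart2 ::
  "'a measure \<Rightarrow> nat \<Rightarrow> nat \<Rightarrow> real \<Rightarrow> real mat \<Rightarrow> ('a \<Rightarrow> real) \<Rightarrow> ('a \<Rightarrow> real) \<Rightarrow> bool" where
  "trace_Wishart2 M p1 p2 \<alpha> \<Sigma> X1 X2 \<longleftrightarrow>
     X1 \<in> borel_measurable M \<and> X2 \<in> borel_measurable M \<and>
     (\<forall>t1\<ge>0. \<forall>t2\<ge>0.
        has_bochner_integral M (\<lambda>\<omega>. exp (- t1 * X1 \<omega> - t2 * X2 \<omega>))
          (det (1\<^sub>m (p1 + p2) +
                diag_block_mat [t1 \<cdot>\<^sub>m 1\<^sub>m p1, t2 \<cdot>\<^sub>m 1\<^sub>m p2] * \<Sigma>) powr (- \<alpha>)))"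

(* x powr q with the convention 0^0 = 1; in the library 0 powr 0 = 0. *)
definition rpow :: "real \<Rightarrow> real \<Rightarrow> real" where
  "rpow x q = (if q = 0 then 1 else x powr q)"

end

theory Submission
  imports Defs "HOL-Real_Asymp.Real_Asymp"
begin

text \<open>
  Fischer's inequality for \<open>T\<^sup>-\<^sup>1 + \<Sigma>\<close>, with \<open>T = diag(t\<^sub>1 I, t\<^sub>2 I)\<close>, says that the joint Laplace transform
  dominates the product of its marginals, so that \<open>1 - exp (- t\<^sub>1 X\<^sub>1)\<close> and \<open>1 - exp (- t\<^sub>2 X\<^sub>2)\<close>
  have nonnegative covariance. For \<open>0 < q < 1\<close> the function \<open>x powr q\<close> is a positive mixture over \<open>t\<close>
  of the functions \<open>1 - exp (- t x)\<close>, and for \<open>q = 1\<close> it is an increasing limit of multiples of them;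
  Tonelli's theorem and monotone convergence carry the covariance inequality over. All moments
  involved are finite because the second difference of the transform of \<open>X\<^sub>1 + X\<^sub>2\<close> at \<open>0\<close> is
  \<open>O(t\<^sup>2)\<close>.

  Fischer's inequality itself is by induction on the last row: the ratio of consecutive leading
  minors is the minimum of the quadratic form over vectors with last coordinate \<open>1\<close>, and this
  minimum can only grow when the vectors are restricted to the second block.
\<close>

subsection \<open>Fischer's inequality\<close>

text \<open>Indices are absolute, so all principal blocks on consecutive indices come from one entry
  function and can be compared without reindexing. The empty block has determinant 1, which starts
  the inductions on \<open>b\<close>.\<close>

definition interval_mat :: "(nat \<Rightarrow> nat \<Rightarrow> 'a) \<Rightarrow> nat \<Rightarrow> nat \<Rightarrow> 'a mat" where
  "interval_mat f a b = mat (b - a) (b - a) (\<lambda>(i, j). f (a + i) (a + j))"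

definition qform :: "(nat \<Rightarrow> nat \<Rightarrow> real) \<Rightarrow> nat \<Rightarrow> nat \<Rightarrow> (nat \<Rightarrow> real) \<Rightarrow> real" where
  "qform f a b x = (\<Sum>i=a..<b. \<Sum>j=a..<b. x i * f i j * x j)"

lemma interval_mat_carrier [simp]: "interval_mat f a b \<in> carrier_mat (b - a) (b - a)"
  by (simp add: interval_mat_def)

lemma det_interval_mat_empty [simp]: "det (interval_mat f a a) = (1 :: 'a :: comm_ring_1)"
  by (simp add: interval_mat_def)

text \<open>Every Leibniz term takes exactly one entry from each row, so it collects each
  \<open>d i\<close> once. This later factors \<open>T\<close> out of
  \<open>I + T * \<Sigma>\<close> and leaves the symmetric matrix
  \<open>T^(-1) + \<Sigma>\<close>.\<close>

lemma det_interval_mat_scale_rows: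
  fixes d :: "nat \<Rightarrow> 'a :: comm_ring_1"
  shows "det (interval_mat (\<lambda>i j. d i * h i j) a b) = (\<Prod>i=a..<b. d i) * det (interval_mat h a b)"
proof -
  have bij: "bij_betw (\<lambda>i. a + i) {0..<b - a} {a..<b}"
    by (rule bij_betw_byWitness[where f' = "\<lambda>i. i - a"]) auto
  have *: "(\<Prod>i=0..<b-a. d (a + i)) = (\<Prod>i=a..<b. d i)"
    by (rule prod.reindex_bij_betw[OF bij])
  show ?thesis
    unfolding det_def'[OF interval_mat_carrier] sum_distrib_left
  proof (rule sum.cong[OF refl])
    fix \<pi> assume "\<pi> \<in> {p. p permutes {0..<b-a}}"
    then have p: "\<pi> i < b - a" if "i < b - a" for i
      using that permutes_in_image[of \<pi> "{0..<b-a}" i] by auto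
    have "(\<Prod>i=0..<b-a. interval_mat (\<lambda>i j. d i * h i j) a b $$ (i, \<pi> i))
        = (\<Prod>i=0..<b-a. d (a + i) * interval_mat h a b $$ (i, \<pi> i))"
      by (rule prod.cong) (auto simp: interval_mat_def p)
    also have "\<dots> = (\<Prod>i=a..<b. d i) * (\<Prod>i=0..<b-a. interval_mat h a b $$ (i, \<pi> i))"
      by (simp add: prod.distrib *)
    finally show "signof \<pi> * (\<Prod>i=0..<b-a. interval_mat (\<lambda>i j. d i * h i j) a b $$ (i, \<pi> i))
        = (\<Prod>i=a..<b. d i) * (signof \<pi> * (\<Prod>i=0..<b-a. interval_mat h a b $$ (i, \<pi> i)))"
      by (simp add: mult_ac)
  qed
qed

lemma interval_mat_split:
  assumes "a \<le> p" "p \<le> b"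
  shows "interval_mat f a b = four_block_mat (interval_mat f a p) (mat (p - a) (b - p) (\<lambda>(i, j). f (a + i) (p + j)))
           (mat (b - p) (p - a) (\<lambda>(i, j). f (p + i) (a + j))) (interval_mat f p b)"
  by (rule eq_matI) (use assms in \<open>auto simp: interval_mat_def add.commute\<close>)

text \<open>Unit rows from \<open>p\<close> on make the matrix block triangular with an identity
  block in the corner. Such rows arise for \<open>t2 = 0\<close>; the mirror lemma below serves
  \<open>t1 = 0\<close>.\<close>

lemma det_interval_mat_lower_unit:
  fixes g :: "nat \<Rightarrow> nat \<Rightarrow> 'a :: idom"
  assumes "a \<le> p" "p \<le> b" and g: "\<And>i j. p \<le> i \<Longrightarrow> g i j = (if i = j then 1 else 0)"
  shows "det (interval_mat g a b) = det (interval_mat g a p)"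
proof -
  have 1: "mat (b - p) (p - a) (\<lambda>(i, j). g (p + i) (a + j)) = 0\<^sub>m (b - p) (p - a)"
    by (rule eq_matI) (auto simp: g)
  have 2: "interval_mat g p b = 1\<^sub>m (b - p)"
    by (rule eq_matI) (auto simp: interval_mat_def g)
  show ?thesis
    unfolding interval_mat_split[OF assms(1,2)] 1 2
    by (subst det_four_block_mat_lower_left_zero[where n = "p - a" and m = "b - p"]) auto
qed

lemma det_interval_mat_upper_unit:
  fixes g :: "nat \<Rightarrow> nat \<Rightarrow> 'a :: idom"
  assumes "a \<le> p" "p \<le> b" and g: "\<And>i j. i < p \<Longrightarrow> g i j = (if i = j then 1 else 0)"
  shows "det (interval_mat g a b) = det (interval_mat g p b)"
proof -
  have 1: "mat (p - a) (b - p) (\<lambda>(i, j). g (a + i) (p + j)) = 0\<^sub>m (p - a) (b - p)"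
    by (rule eq_matI) (use assms(1) in \<open>auto simp: g\<close>)
  have 2: "interval_mat g a p = 1\<^sub>m (p - a)"
    by (rule eq_matI) (use assms(1) in \<open>auto simp: interval_mat_def g\<close>)
  show ?thesis
    unfolding interval_mat_split[OF assms(1,2)] 1 2
    by (subst det_four_block_mat_upper_right_zero[where n = "p - a" and m = "b - p"]) auto
qed

section \<open>Ratios of consecutive leading minors as minima of quadratic forms\<close>

text \<open>The vector \<open>x\<close> is the last column of the adjugate, divided by the leading minor.\<close>

lemma det_interval_mat_Suc:
  fixes f :: "nat \<Rightarrow> nat \<Rightarrow> 'a :: field"
  assumes "a \<le> b" and nz: "det (interval_mat f a b) \<noteq> 0"
  obtains x where "x b = 1" "\<And>i. i \<in> {a..<b} \<Longrightarrow> (\<Sum>j=a..<Suc b. f i j * x j) = 0"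
    "det (interval_mat f a (Suc b)) = det (interval_mat f a b) * (\<Sum>j=a..<Suc b. f b j * x j)"
proof -
  define n where "n = b - a"
  define A where "A = interval_mat f a (Suc b)"
  have A: "A \<in> carrier_mat (Suc n) (Suc n)"
    using assms(1) by (simp add: A_def n_def interval_mat_def Suc_diff_le)
  have del: "mat_delete A n n = interval_mat f a b"
    using assms(1) by (intro eq_matI) (auto simp: A_def n_def interval_mat_def mat_delete_def Suc_diff_le)
  define x where "x j = adj_mat A $$ (j - a, n) / det (interval_mat f a b)" for j
  have sum: "(\<Sum>j=a..<Suc b. f i j * x j) * det (interval_mat f a b) = (if i = b then det A else 0)"
    if i: "i \<in> {a..<Suc b}" for i
  proof -
    have bij: "bij_betw (\<lambda>i. a + i) {0..<Suc n} {a..<Suc b}"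
      by (rule bij_betw_byWitness[where f' = "\<lambda>i. i - a"]) (use assms(1) in \<open>auto simp: n_def\<close>)
    have "(\<Sum>j=a..<Suc b. f i j * x j) * det (interval_mat f a b)
        = (\<Sum>j=a..<Suc b. f i j * adj_mat A $$ (j - a, n))"
      unfolding sum_distrib_right using nz by (intro sum.cong refl) (simp add: x_def)
    also have "\<dots> = (\<Sum>k=0..<Suc n. f i (a + k) * adj_mat A $$ (k, n))"
      by (subst sum.reindex_bij_betw[OF bij, symmetric]) simp
    also have "\<dots> = (\<Sum>k=0..<Suc n. A $$ (i - a, k) * adj_mat A $$ (k, n))"
      using i by (intro sum.cong refl) (auto simp: A_def interval_mat_def n_def)
    also have "\<dots> = (A * adj_mat A) $$ (i - a, n)"
      using A adj_mat(1)[OF A] i by (auto simp: scalar_prod_def n_def)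
    also have "\<dots> = (if i = b then det A else 0)"
      using i by (auto simp: adj_mat(2)[OF A] n_def)
    finally show ?thesis .
  qed
  show ?thesis
  proof
    show "x b = 1"
      using A nz by (simp add: x_def adj_mat_def n_def[symmetric] cofactor_def del)
    show "(\<Sum>j=a..<Suc b. f i j * x j) = 0" if "i \<in> {a..<b}" for i
      using sum[of i] that nz by auto
    show "det (interval_mat f a (Suc b)) = det (interval_mat f a b) * (\<Sum>j=a..<Suc b. f b j * x j)"
      using sum[of b] assms(1) by (simp add: A_def mult.commute)
  qed
qed

text \<open>Write \<open>y = x + w\<close> with \<open>w b = 0\<close>. On the block,
  \<open>f\<close> sends \<open>x\<close> to a multiple of the last unit vector, so the cross terms
  with \<open>w\<close> vanish; what remains is the value at \<open>x\<close> and the form of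
  \<open>w\<close> on the smaller block.\<close>

lemma qform_complete_square:
  assumes "a \<le> b" and sym: "\<And>i j. f i j = f j i"
    and x: "x b = 1" "\<And>i. i \<in> {a..<b} \<Longrightarrow> (\<Sum>j=a..<Suc b. f i j * x j) = 0"
    and y: "y b = 1"
  shows "qform f a (Suc b) y = (\<Sum>j=a..<Suc b. f b j * x j) + qform f a b (\<lambda>i. y i - x i)"
proof -
  define w where "w i = y i - x i" for i
  define s where "s = (\<Sum>j=a..<Suc b. f b j * x j)"
  have wb: "w b = 0" using x y by (simp add: w_def)
  have s: "(\<Sum>j=a..<Suc b. f i j * x j) = (if i = b then s else 0)" if "i \<in> {a..<Suc b}" for i
    using that x(2)[of i] by (auto simp: s_def)
  have lin: "(\<Sum>i=a..<Suc b. v i * (\<Sum>j=a..<Suc b. f i j * x j)) = v b * s" for v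
  proof -
    have "(\<Sum>i=a..<Suc b. v i * (\<Sum>j=a..<Suc b. f i j * x j))
        = (\<Sum>i=a..<Suc b. if b = i then v i * s else 0)"
      using s by (intro sum.cong refl) auto
    then show ?thesis using assms(1) by simp
  qed
  \<comment> \<open>By symmetry this cross term pairs \<open>w\<close> with the image of
    \<open>x\<close>, so \<open>lin\<close> evaluates it to \<open>w b * s = 0\<close>; the term
    with \<open>y\<close> gives \<open>y b * s = s\<close>.\<close>
  have cross: "(\<Sum>i=a..<Suc b. \<Sum>j=a..<Suc b. x i * f i j * w j)
      = (\<Sum>i=a..<Suc b. w i * (\<Sum>j=a..<Suc b. f i j * x j))"
    unfolding sum_distrib_left by (subst sum.swap, intro sum.cong refl) (metis sym mult.commute mult.assoc)
  have "qform f a (Suc b) y = (\<Sum>i=a..<Suc b. \<Sum>j=a..<Suc b.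
      y i * (f i j * x j) + x i * f i j * w j + w i * f i j * w j)"
    unfolding qform_def by (intro sum.cong refl) (simp add: w_def algebra_simps)
  also have "\<dots> = (\<Sum>i=a..<Suc b. y i * (\<Sum>j=a..<Suc b. f i j * x j))
      + (\<Sum>i=a..<Suc b. \<Sum>j=a..<Suc b. x i * f i j * w j) + qform f a (Suc b) w"
    by (simp only: sum.distrib qform_def sum_distrib_left)
  also have "qform f a (Suc b) w = qform f a b w"
    using assms(1) by (simp add: qform_def wb)
  finally show ?thesis
    unfolding cross lin wb y s_def by (simp add: w_def[abs_def] del: sum.op_ivl_Suc)
qed

lemma qform_restrict:
  assumes "a' \<le> a" "b \<le> b'"
  shows "qform f a' b' (\<lambda>i. if i \<in> {a..<b} then x i else 0) = qform f a b x"
proof -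
  have "qform f a b x = (\<Sum>i=a..<b. \<Sum>j=a'..<b'. x i * f i j * (if j \<in> {a..<b} then x j else 0))"
    unfolding qform_def using assms by (intro sum.cong refl sum.mono_neutral_cong_left) auto
  also have "\<dots> = qform f a' b' (\<lambda>i. if i \<in> {a..<b} then x i else 0)"
    unfolding qform_def using assms by (intro sum.mono_neutral_cong_left) auto
  finally show ?thesis ..
qed

text \<open>The minimiser is the vector annihilated by the rows before \<open>b\<close>: completing
  the square leaves the form of \<open>y - x\<close> on \<open>{a..<b}\<close>, which is
  nonnegative. Its value there is the ratio of the two minors.\<close>

lemma det_interval_mat_Suc_min:
  assumes "a \<le> b" and sym: "\<And>i j. f i j = f j i"
    and pos: "det (interval_mat f a b) > 0" and psd: "\<And>x. qform f a b x \<ge> 0"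
  obtains x where "x b = 1" "det (interval_mat f a (Suc b)) = det (interval_mat f a b) * qform f a (Suc b) x"
    "\<And>y. y b = 1 \<Longrightarrow> qform f a (Suc b) x \<le> qform f a (Suc b) y"
proof -
  obtain x where x: "x b = 1" "\<And>i. i \<in> {a..<b} \<Longrightarrow> (\<Sum>j=a..<Suc b. f i j * x j) = 0"
    "det (interval_mat f a (Suc b)) = det (interval_mat f a b) * (\<Sum>j=a..<Suc b. f b j * x j)"
    by (rule det_interval_mat_Suc[OF assms(1) less_imp_neq[OF pos, symmetric]]) blast
  note sq = qform_complete_square[where f = f, OF assms(1) sym x(1,2)]
  have qx: "qform f a (Suc b) x = (\<Sum>j=a..<Suc b. f b j * x j)"
    using sq[of x] x(1) by (simp add: qform_def)
  show ?thesis
    by (rule that[of x]) (use x(1,3) sq psd in \<open>simp_all add: qx\<close>)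
qed

text \<open>The easy half of Sylvester's criterion: each ratio of consecutive minors is the value of
  the form at a vector with last coordinate 1, hence at a nonzero vector, so it is positive.\<close>

lemma det_interval_mat_pos:
  assumes sym: "\<And>i j. f i j = f j i"
    and pd: "\<And>x. \<exists>i<n. x i \<noteq> 0 \<Longrightarrow> qform f 0 n x > 0"
    and "a \<le> b" "b \<le> n"
  shows "det (interval_mat f a b) > 0"
  using assms(3,4)
proof (induction b rule: dec_induct)
  case base
  show ?case by simp
next
  case (step b)
  have res: "qform f a c x = qform f 0 n (\<lambda>i. if i \<in> {a..<c} then x i else 0)" if "c \<le> n" for x c
    using that by (intro qform_restrict[symmetric]) auto
  have psd: "qform f a b x \<ge> 0" for x
  proof (cases "\<exists>i\<in>{a..<b}. x i \<noteq> 0")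
    case True
    then show ?thesis using step.prems by (subst res) (auto intro!: less_imp_le pd)
  next
    case False
    then show ?thesis by (simp add: qform_def)
  qed
  obtain x where x: "x b = 1" "det (interval_mat f a (Suc b)) = det (interval_mat f a b) * qform f a (Suc b) x"
    by (rule det_interval_mat_Suc_min[of a b f, OF step.hyps(1) sym _ psd]) (use step in auto)
  have "qform f a (Suc b) x > 0"
    using x(1) step by (subst res) (auto intro!: pd exI[of _ b])
  with x(2) step.IH step.prems show ?case by (simp del: sum.op_ivl_Suc)
qed

text \<open>Passing from \<open>b\<close> to \<open>Suc b\<close> multiplies the left side and the
  last factor on the right each by a minimum of the form over vectors with coordinate
  \<open>b\<close> equal to 1. The left minimum runs over more vectors, so it is at most the right
  one.\<close>

lemma Fischer_inequality:
  assumes sym: "\<And>i j. f i j = f j i"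
    and pd: "\<And>x. \<exists>i<n. x i \<noteq> 0 \<Longrightarrow> qform f 0 n x > 0"
    and "p \<le> b" "b \<le> n"
  shows "det (interval_mat f 0 b) \<le> det (interval_mat f 0 p) * det (interval_mat f p b)"
  using assms(3,4)
proof (induction b rule: dec_induct)
  case base
  show ?case by simp
next
  case (step b)
  have res: "qform f a c x = qform f 0 n (\<lambda>i. if i \<in> {a..<c} then x i else 0)" if "c \<le> n" for x a c
    using that by (intro qform_restrict[symmetric]) auto
  have psd: "qform f a b x \<ge> 0" for x a
  proof (cases "\<exists>i\<in>{a..<b}. x i \<noteq> 0")
    case True
    then show ?thesis using step.prems by (subst res) (auto intro!: less_imp_le pd)
  next
    case False
    then show ?thesis by (simp add: qform_def)
  qed
  have pos: "det (interval_mat f 0 b) > 0" "det (interval_mat f 0 p) > 0" "det (interval_mat f p b) > 0"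
    using step det_interval_mat_pos[where f = f, OF sym pd] by auto
  obtain x where x: "det (interval_mat f 0 (Suc b)) = det (interval_mat f 0 b) * qform f 0 (Suc b) x"
    "\<And>y. y b = 1 \<Longrightarrow> qform f 0 (Suc b) x \<le> qform f 0 (Suc b) y"
    by (rule det_interval_mat_Suc_min[of 0 b f, OF _ sym pos(1) psd]) auto
  obtain y where y: "y b = 1" "det (interval_mat f p (Suc b)) = det (interval_mat f p b) * qform f p (Suc b) y"
    by (rule det_interval_mat_Suc_min[of p b f, OF step.hyps(1) sym pos(3) psd]) auto
  \<comment> \<open>Extended by 0 below \<open>p\<close>, the minimiser of the second block competes
    for the minimum over the whole block.\<close>
  have "qform f p (Suc b) y = qform f 0 (Suc b) (\<lambda>i. if i \<in> {p..<Suc b} then y i else 0)"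
    by (rule qform_restrict[symmetric]) auto
  then have le: "qform f 0 (Suc b) x \<le> qform f p (Suc b) y"
    using x(2)[of "\<lambda>i. if i \<in> {p..<Suc b} then y i else 0"] y(1) step.hyps by simp
  have nn: "qform f p (Suc b) y \<ge> 0"
    using y(1) step by (subst res) (auto intro!: less_imp_le pd exI[of _ b])
  have "det (interval_mat f 0 (Suc b)) \<le> det (interval_mat f 0 b) * qform f p (Suc b) y"
    using le pos(1) by (simp add: x(1))
  also have "\<dots> \<le> det (interval_mat f 0 p) * det (interval_mat f p b) * qform f p (Suc b) y"
    using step nn by (intro mult_right_mono) auto
  finally show ?case by (simp add: y(2) mult.assoc)
qed

text \<open>The same induction made quantitative: each ratio of minors is the form at a vector with
  last coordinate 1, hence at least the square of that coordinate.\<close>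

lemma det_interval_mat_ge_1:
  assumes sym: "\<And>i j. f i j = f j i"
    and ge: "\<And>x. qform f 0 n x \<ge> (\<Sum>i<n. (x i)\<^sup>2)"
    and "a \<le> b" "b \<le> n"
  shows "det (interval_mat f a b) \<ge> 1"
  using assms(3,4)
proof (induction b rule: dec_induct)
  case base
  show ?case by simp
next
  case (step b)
  have res: "qform f a c x \<ge> (\<Sum>i=a..<c. (x i)\<^sup>2)" if "c \<le> n" for x c
  proof -
    have "(\<Sum>i=a..<c. (x i)\<^sup>2) = (\<Sum>i<n. (if i \<in> {a..<c} then x i else 0)\<^sup>2)"
      using that by (intro sum.mono_neutral_cong_left) auto
    also have "\<dots> \<le> qform f a c x"
      using ge[of "\<lambda>i. if i \<in> {a..<c} then x i else 0"] qform_restrict[of 0 a c n f x] that by simp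
    finally show ?thesis .
  qed
  have psd: "qform f a b x \<ge> 0" for x
    using res[of b x] step.prems by (meson Suc_leD order_trans sum_nonneg zero_le_power2)
  obtain x where x: "x b = 1" "det (interval_mat f a (Suc b)) = det (interval_mat f a b) * qform f a (Suc b) x"
    by (rule det_interval_mat_Suc_min[of a b f, OF step.hyps(1) sym _ psd]) (use step in auto)
  have "(x b)\<^sup>2 \<le> (\<Sum>i=a..<Suc b. (x i)\<^sup>2)"
    using step.hyps by (intro member_le_sum) auto
  with res[of "Suc b" x] x(1) step.prems have "qform f a (Suc b) x \<ge> 1" by simp
  with x(2) step show ?case by (simp add: mult_ge1_I)
qed

subsection \<open>The Laplace transform of the trace-Wishart distribution\<close>

text \<open>A general \<open>d\<close> covers the joint transform, where it takes two values; a
  constant \<open>d\<close> covers the marginals and the transform of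
  \<open>X1 + X2\<close>.\<close>

definition wishart_det :: "(nat \<Rightarrow> nat \<Rightarrow> real) \<Rightarrow> (nat \<Rightarrow> real) \<Rightarrow> nat \<Rightarrow> nat \<Rightarrow> real" where
  "wishart_det f d a b = det (interval_mat (\<lambda>i j. (if i = j then 1 else 0) + d i * f i j) a b)"

lemma qform_add_diag:
  "qform (\<lambda>i j. (if i = j then c i else 0) + f i j) a b x = (\<Sum>i=a..<b. c i * (x i)\<^sup>2) + qform f a b x"
proof -
  have "qform (\<lambda>i j. (if i = j then c i else 0) + f i j) a b x
      = (\<Sum>i=a..<b. \<Sum>j=a..<b. (if i = j then c i * (x i)\<^sup>2 else 0) + x i * f i j * x j)"
    unfolding qform_def by (intro sum.cong refl) (auto simp: algebra_simps power2_eq_square)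
  also have "\<dots> = (\<Sum>i=a..<b. c i * (x i)\<^sup>2) + qform f a b x"
    by (simp add: sum.distrib qform_def)
  finally show ?thesis .
qed

text \<open>\<open>I + D f\<close> need not be symmetric, but it equals
  \<open>D (D^(-1) + f)\<close>, whose second factor is symmetric and positive definite. The
  products of the \<open>d i\<close> over the two blocks multiply to the full one, so Fischer's
  inequality survives the scaling.\<close>

lemma
  assumes sym: "\<And>i j. f i j = f j i" and psd: "\<And>x. qform f 0 n x \<ge> 0"
    and d: "\<And>i. d i > 0" and "p \<le> n"
  shows wishart_det_pos: "wishart_det f d 0 n > 0"
    and wishart_det_Fischer: "wishart_det f d 0 n \<le> wishart_det f d 0 p * wishart_det f d p n"
proof -
  define g where "g i j = (if i = j then 1 / d i else 0) + f i j" for i j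
  have g: "(\<lambda>i j. (if i = j then 1 else 0) + d i * f i j) = (\<lambda>i j. d i * g i j)"
    using d by (auto simp: g_def fun_eq_iff algebra_simps less_imp_neq[symmetric])
  have eq: "wishart_det f d a b = (\<Prod>i=a..<b. d i) * det (interval_mat g a b)" for a b
    unfolding wishart_det_def g det_interval_mat_scale_rows ..
  have gsym: "g i j = g j i" for i j
    by (auto simp: g_def sym)
  have gpd: "qform g 0 n x > 0" if "\<exists>i<n. x i \<noteq> 0" for x
  proof -
    have "(\<Sum>i=0..<n. (1 / d i) * (x i)\<^sup>2) > 0"
    proof -
      from that obtain i where "i < n" "x i \<noteq> 0" by auto
      then show ?thesis
        using d by (intro sum_pos2[where i = i]) (auto simp: less_imp_le)
    qed
    then show ?thesis
      unfolding g_def qform_add_diag using psd[of x] by linarith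
  qed
  have dpos: "(\<Prod>i=a..<b. d i) > 0" for a b
    by (intro prod_pos) (auto simp: d)
  show "wishart_det f d 0 n > 0"
    unfolding eq using dpos det_interval_mat_pos[of g n 0 n, OF gsym gpd] by simp
  have "(\<Prod>i=0..<n. d i) * det (interval_mat g 0 n)
      \<le> (\<Prod>i=0..<n. d i) * (det (interval_mat g 0 p) * det (interval_mat g p n))"
    using dpos Fischer_inequality[of g n p n, OF gsym gpd] assms(4)
    by (intro mult_left_mono) (auto simp: less_imp_le)
  also have "\<dots> = ((\<Prod>i=0..<p. d i) * det (interval_mat g 0 p)) * ((\<Prod>i=p..<n. d i) * det (interval_mat g p n))"
    using assms(4) by (simp add: mult_ac flip: prod.atLeastLessThan_concat[of 0 p n])
  finally show "wishart_det f d 0 n \<le> wishart_det f d 0 p * wishart_det f d p n"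
    unfolding eq .
qed

text \<open>For constant \<open>d\<close> the matrix \<open>I + t f\<close> is itself symmetric, so
  \<open>t\<close> is never inverted and \<open>t = 0\<close> is included. Its form is the squared
  norm plus a nonnegative term.\<close>

lemma wishart_det_const_ge_1:
  assumes sym: "\<And>i j. f i j = f j i" and psd: "\<And>x. qform f 0 n x \<ge> 0"
    and "0 \<le> t" "a \<le> b" "b \<le> n"
  shows "wishart_det f (\<lambda>_. t) a b \<ge> 1"
  unfolding wishart_det_def
proof (rule det_interval_mat_ge_1[OF _ _ assms(4,5)])
  fix x
  have "qform (\<lambda>i j. t * f i j) 0 n x = t * qform f 0 n x"
    by (simp add: qform_def sum_distrib_left mult_ac)
  then show "(\<Sum>i<n. (x i)\<^sup>2) \<le> qform (\<lambda>i j. (if i = j then 1 else 0) + t * f i j) 0 n x"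
    using psd[of x] assms(3) by (simp add: qform_add_diag atLeast0LessThan)
qed (auto simp: sym)

text \<open>The same determinant is formed over polynomials in \<open>t\<close>; evaluation is a
  ring homomorphism and passes through the Leibniz formula. This supplies the smoothness behind the
  moment bound.\<close>

lemma wishart_det_const_poly: "\<exists>P. \<forall>t. wishart_det f (\<lambda>_. t) a b = poly P t"
proof -
  define P where "P = det (interval_mat (\<lambda>i j. [:if i = j then 1 else 0, f i j:]) a b)"
  have sgn: "poly (signof \<pi>) t = signof \<pi>" for \<pi> :: "nat \<Rightarrow> nat" and t :: real
    by (simp add: sign_def)
  have "wishart_det f (\<lambda>_. t) a b = poly P t" for t
  proof -
    have *: "poly (interval_mat (\<lambda>i j. [:if i = j then 1 else 0, f i j:]) a b $$ (i, \<pi> i)) t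
        = interval_mat (\<lambda>i j. (if i = j then 1 else 0) + t * f i j) a b $$ (i, \<pi> i)"
      if "\<pi> permutes {0..<b-a}" "i < b - a" for \<pi> i
      using that permutes_in_image[of \<pi> "{0..<b-a}" i] by (auto simp: interval_mat_def)
    show ?thesis
      unfolding P_def wishart_det_def det_def'[OF interval_mat_carrier] poly_sum poly_mult poly_prod sgn
      by (intro sum.cong refl arg_cong2[where f = "(*)"] prod.cong) (auto simp: *)
  qed
  then show ?thesis by blast
qed

section \<open>Determinants in the trace-Wishart transform\<close>

context
  fixes p1 p2 :: nat and \<Sigma> :: "real mat"
  assumes \<Sigma>: "sym_pos_semidef (p1 + p2) \<Sigma>"
begin

text \<open>The value 0 outside the matrix makes symmetry hold for all indices, as the lemmas on
  entry functions ask.\<close>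

private definition f where
  "f i j = (if i < p1 + p2 \<and> j < p1 + p2 then \<Sigma> $$ (i, j) else 0)"

private definition L where
  "L t1 t2 = det (1\<^sub>m (p1 + p2) + diag_block_mat [t1 \<cdot>\<^sub>m 1\<^sub>m p1, t2 \<cdot>\<^sub>m 1\<^sub>m p2] * \<Sigma>)"

private lemma L_eq: "L t1 t2 = wishart_det f (\<lambda>i. if i < p1 then t1 else t2) 0 (p1 + p2)"
proof -
  let ?D = "diag_block_mat [t1 \<cdot>\<^sub>m 1\<^sub>m p1, t2 \<cdot>\<^sub>m 1\<^sub>m p2]"
  have S: "\<Sigma> \<in> carrier_mat (p1 + p2) (p1 + p2)"
    using \<Sigma> by (simp add: sym_pos_semidef_def)
  have D: "?D \<in> carrier_mat (p1 + p2) (p1 + p2)"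
    by (intro carrier_matI) (simp_all add: Let_def)
  have Dij: "?D $$ (i, j) = (if i = j then if i < p1 then t1 else t2 else 0)"
    if "i < p1 + p2" "j < p1 + p2" for i j
    using that by (auto simp: Let_def)
  have DS: "(?D * \<Sigma>) $$ (i, j) = (if i < p1 then t1 else t2) * \<Sigma> $$ (i, j)"
    if ij: "i < p1 + p2" "j < p1 + p2" for i j
  proof -
    have "(?D * \<Sigma>) $$ (i, j) = (\<Sum>k=0..<p1+p2. ?D $$ (i, k) * \<Sigma> $$ (k, j))"
      using S D ij by (simp add: scalar_prod_def del: diag_block_mat.simps)
    also have "\<dots> = (\<Sum>k=0..<p1+p2. if i = k then (if i < p1 then t1 else t2) * \<Sigma> $$ (k, j) else 0)"
      using ij by (intro sum.cong refl) (simp add: Dij del: diag_block_mat.simps)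
    finally show ?thesis using ij by simp
  qed
  have "1\<^sub>m (p1 + p2) + ?D * \<Sigma>
      = interval_mat (\<lambda>i j. (if i = j then 1 else 0) + (if i < p1 then t1 else t2) * f i j) 0 (p1 + p2)"
    using S D by (intro eq_matI) (auto simp: interval_mat_def f_def DS simp del: diag_block_mat.simps index_mult_mat(1))
  then show ?thesis by (simp add: L_def wishart_det_def)
qed

private lemma f_sym: "f i j = f j i"
proof -
  have "\<Sigma> $$ (i, j) = transpose_mat \<Sigma> $$ (i, j)"
    using \<Sigma> by (simp add: sym_pos_semidef_def)
  also have "\<dots> = \<Sigma> $$ (j, i)" if "i < p1 + p2" "j < p1 + p2"
    using \<Sigma> that by (subst index_transpose_mat) (auto simp: sym_pos_semidef_def)
  finally show ?thesis by (auto simp: f_def)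
qed

private lemma f_psd: "qform f 0 (p1 + p2) x \<ge> 0"
proof -
  have S: "\<Sigma> \<in> carrier_mat (p1 + p2) (p1 + p2)"
    using \<Sigma> by (simp add: sym_pos_semidef_def)
  have "qform f 0 (p1 + p2) x
      = (\<Sum>i=0..<p1+p2. x i * (\<Sum>j=0..<p1+p2. \<Sigma> $$ (i, j) * x j))"
    unfolding qform_def sum_distrib_left by (intro sum.cong refl) (auto simp: f_def)
  also have "\<dots> = scalar_prod (vec (p1 + p2) x) (\<Sigma> *\<^sub>v vec (p1 + p2) x)"
    using S by (auto simp: scalar_prod_def intro!: sum.cong)
  also have "\<dots> \<ge> 0"
    using \<Sigma> by (simp add: sym_pos_semidef_def)
  finally show ?thesis .
qed

private lemma L_left: "L t1 0 = wishart_det f (\<lambda>_. t1) 0 p1"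
proof -
  have "L t1 0 = wishart_det f (\<lambda>i. if i < p1 then t1 else 0) 0 p1"
    unfolding L_eq wishart_det_def by (rule det_interval_mat_lower_unit) auto
  also have "\<dots> = wishart_det f (\<lambda>_. t1) 0 p1"
    unfolding wishart_det_def by (intro arg_cong[where f = det] eq_matI) (auto simp: interval_mat_def)
  finally show ?thesis .
qed

private lemma L_right: "L 0 t2 = wishart_det f (\<lambda>_. t2) p1 (p1 + p2)"
proof -
  have "L 0 t2 = wishart_det f (\<lambda>i. if i < p1 then 0 else t2) p1 (p1 + p2)"
    unfolding L_eq wishart_det_def by (rule det_interval_mat_upper_unit) auto
  also have "\<dots> = wishart_det f (\<lambda>_. t2) p1 (p1 + p2)"
    unfolding wishart_det_def by (intro arg_cong[where f = det] eq_matI) (auto simp: interval_mat_def)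
  finally show ?thesis .
qed

private lemma L_diag: "L t t = wishart_det f (\<lambda>_. t) 0 (p1 + p2)"
  by (simp add: L_eq)

lemma det_TW_left_ge_1: "t \<ge> 0 \<Longrightarrow>
    det (1\<^sub>m (p1 + p2) + diag_block_mat [t \<cdot>\<^sub>m 1\<^sub>m p1, 0 \<cdot>\<^sub>m 1\<^sub>m p2] * \<Sigma>) \<ge> 1"
  using wishart_det_const_ge_1[of f "p1 + p2" t 0 p1, OF f_sym f_psd]
  unfolding L_left[unfolded L_def] by linarith

lemma det_TW_right_ge_1: "t \<ge> 0 \<Longrightarrow>
    det (1\<^sub>m (p1 + p2) + diag_block_mat [0 \<cdot>\<^sub>m 1\<^sub>m p1, t \<cdot>\<^sub>m 1\<^sub>m p2] * \<Sigma>) \<ge> 1"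
  using wishart_det_const_ge_1[of f "p1 + p2" t p1 "p1 + p2", OF f_sym f_psd]
  unfolding L_right[unfolded L_def] by linarith

text \<open>Equal arguments give the transform of \<open>X1 + X2\<close>, which is thus a power of a
  polynomial bounded below by 1.\<close>

lemma det_TW_diag_poly: "\<exists>P. (\<forall>t\<ge>0. poly P t \<ge> 1) \<and>
    (\<forall>t. det (1\<^sub>m (p1 + p2) + diag_block_mat [t \<cdot>\<^sub>m 1\<^sub>m p1, t \<cdot>\<^sub>m 1\<^sub>m p2] * \<Sigma>) = poly P t)"
proof -
  obtain P where P: "\<forall>t. L t t = poly P t"
    unfolding L_diag using wishart_det_const_poly ..
  moreover have "L t t \<ge> 1" if "t \<ge> 0" for t
    unfolding L_diag by (rule wishart_det_const_ge_1[OF f_sym f_psd that]) auto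
  ultimately show ?thesis unfolding L_def[symmetric] by metis
qed

text \<open>The weight is constant on each block, so the two factors from Fischer's inequality are
  the marginal determinants. Positive arguments allow the weights to be inverted.\<close>

lemma det_TW_pos_Fischer:
  assumes "t1 > 0" "t2 > 0"
  shows "det (1\<^sub>m (p1 + p2) + diag_block_mat [t1 \<cdot>\<^sub>m 1\<^sub>m p1, t2 \<cdot>\<^sub>m 1\<^sub>m p2] * \<Sigma>) > 0"
    and "det (1\<^sub>m (p1 + p2) + diag_block_mat [t1 \<cdot>\<^sub>m 1\<^sub>m p1, t2 \<cdot>\<^sub>m 1\<^sub>m p2] * \<Sigma>)
      \<le> det (1\<^sub>m (p1 + p2) + diag_block_mat [t1 \<cdot>\<^sub>m 1\<^sub>m p1, 0 \<cdot>\<^sub>m 1\<^sub>m p2] * \<Sigma>)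
       * det (1\<^sub>m (p1 + p2) + diag_block_mat [0 \<cdot>\<^sub>m 1\<^sub>m p1, t2 \<cdot>\<^sub>m 1\<^sub>m p2] * \<Sigma>)"
proof -
  let ?d = "\<lambda>i. if i < p1 then t1 else t2"
  have d: "?d i > 0" for i using assms by simp
  have 1: "wishart_det f ?d 0 p1 = wishart_det f (\<lambda>_. t1) 0 p1"
    unfolding wishart_det_def by (intro arg_cong[where f = det] eq_matI) (auto simp: interval_mat_def)
  have 2: "wishart_det f ?d p1 (p1 + p2) = wishart_det f (\<lambda>_. t2) p1 (p1 + p2)"
    unfolding wishart_det_def by (intro arg_cong[where f = det] eq_matI) (auto simp: interval_mat_def)
  have "L t1 t2 > 0"
    unfolding L_eq by (rule wishart_det_pos[OF f_sym f_psd d le_add1])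
  then show "det (1\<^sub>m (p1 + p2) + diag_block_mat [t1 \<cdot>\<^sub>m 1\<^sub>m p1, t2 \<cdot>\<^sub>m 1\<^sub>m p2] * \<Sigma>) > 0"
    by (simp only: L_def)
  have "L t1 t2 \<le> L t1 0 * L 0 t2"
    unfolding L_left L_right unfolding L_eq
    using wishart_det_Fischer[of f "p1 + p2" ?d p1, OF f_sym f_psd d le_add1] unfolding 1 2 .
  then show "det (1\<^sub>m (p1 + p2) + diag_block_mat [t1 \<cdot>\<^sub>m 1\<^sub>m p1, t2 \<cdot>\<^sub>m 1\<^sub>m p2] * \<Sigma>)
      \<le> det (1\<^sub>m (p1 + p2) + diag_block_mat [t1 \<cdot>\<^sub>m 1\<^sub>m p1, 0 \<cdot>\<^sub>m 1\<^sub>m p2] * \<Sigma>)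
       * det (1\<^sub>m (p1 + p2) + diag_block_mat [0 \<cdot>\<^sub>m 1\<^sub>m p1, t2 \<cdot>\<^sub>m 1\<^sub>m p2] * \<Sigma>)"
    by (simp only: L_def)
qed

end

subsection \<open>Powers as mixtures of exponentials\<close>

text \<open>The difference quotient of \<open>1 - exp (- x * h)\<close> in \<open>h\<close> at 0,
  with step \<open>h = 1 / 2 ^ n\<close>. Dyadic steps make successive quotients comparable through
  one squaring.\<close>

definition exp_quotient :: "nat \<Rightarrow> real \<Rightarrow> real" where
  "exp_quotient n x = 2 ^ n * (1 - exp (- x / 2 ^ n))"

lemma exp_quotient_nonneg: "x \<ge> 0 \<Longrightarrow> exp_quotient n x \<ge> 0"
  by (simp add: exp_quotient_def)

lemma exp_quotient_mono: "exp_quotient n x \<le> exp_quotient (Suc n) x"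
proof -
  \<comment> \<open>Halving the step replaces \<open>u\<^sup>2\<close> by \<open>u\<close>, and the
    gain is a multiple of the perfect square \<open>(1 - u)\<^sup>2\<close>.\<close>
  define u where "u = exp (- x / 2 ^ Suc n)"
  have "exp (- x / 2 ^ n) = u\<^sup>2"
    unfolding u_def by (simp add: exp_double[symmetric])
  moreover have "2 * (1 - u) - (1 - u\<^sup>2) = (1 - u)\<^sup>2"
    by (simp add: power2_eq_square algebra_simps)
  then have "1 - u\<^sup>2 \<le> 2 * (1 - u)"
    by (metis diff_ge_0_iff_ge zero_le_power2)
  ultimately show ?thesis
    unfolding exp_quotient_def u_def[symmetric] by simp
qed

lemma exp_quotient_tendsto: "(\<lambda>n. exp_quotient n x) \<longlonglongrightarrow> x"
proof -
  have D: "((\<lambda>h. (1 - exp (- x * h)) / h) \<longlongrightarrow> x) (at_right 0)"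
    by real_asymp
  have "filterlim (\<lambda>n. inverse (2 ^ n :: real)) (at_right 0) sequentially"
    by real_asymp
  from filterlim_compose[OF D this] show ?thesis
    by (simp add: exp_quotient_def field_simps)
qed

lemma exp_quotient_le: "exp_quotient n x \<le> x"
  using exp_quotient_mono[of _ x] by (intro incseq_le[OF _ exp_quotient_tendsto] incseq_SucI)

lemma SUP_ennreal_exp_quotient: "x \<ge> 0 \<Longrightarrow> (SUP n. ennreal (exp_quotient n x)) = ennreal x"
  by (intro LIMSEQ_unique[OF LIMSEQ_SUP tendsto_ennrealI[OF exp_quotient_tendsto]] incseq_SucI ennreal_leI exp_quotient_mono)

lemma SUP_ennreal_exp_quotient_sq: "x \<ge> 0 \<Longrightarrow> (SUP n. ennreal ((exp_quotient n x)\<^sup>2)) = ennreal (x\<^sup>2)"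
  by (intro LIMSEQ_unique[OF LIMSEQ_SUP tendsto_ennrealI[OF tendsto_power[OF exp_quotient_tendsto]]]
       incseq_SucI ennreal_leI power_mono exp_quotient_mono exp_quotient_nonneg)

text \<open>Substituting \<open>t / x\<close> for \<open>t\<close> pulls out
  \<open>x powr q\<close>: the weight contributes \<open>x powr (q + 1)\<close> and the measure
  \<open>1 / x\<close>. The constant \<open>K\<close> is the integral at \<open>x = 1\<close>; being
  positive and finite, it can be cancelled later.\<close>

lemma nn_integral_one_minus_exp_powr:
  fixes q :: real
  assumes q: "0 < q" "q < 1"
  obtains K :: ennreal where "0 < K" "K < \<infinity>"
    "\<And>x. x \<ge> 0 \<Longrightarrow>
      (\<integral>\<^sup>+t. ennreal ((1 - exp (- t * x)) * t powr (- q - 1)) * indicator {0<..} t \<partial>lborel) = K * ennreal (x powr q)"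
proof -
  define h where "h x t = ennreal ((1 - exp (- t * x)) * t powr (- q - 1)) * indicator {0<..} t" for x t :: real
  have [measurable]: "h x \<in> borel_measurable borel" for x
    unfolding h_def by measurable
  define K where "K = (\<integral>\<^sup>+t. h 1 t \<partial>lborel)"
  \<comment> \<open>Finiteness of \<open>K\<close>: near 0 the bound
    \<open>1 - exp (- t) \<le> t\<close> leaves \<open>t powr (- q)\<close>, integrable since
    \<open>q < 1\<close>; beyond 1 the bound by 1 leaves \<open>t powr (- q - 1)\<close>, integrable
    since \<open>q > 0\<close>.\<close>
  have "h 1 t \<le> ennreal (t powr (- q)) * indicator {0..1} t + ennreal (t powr (- q - 1)) * indicator {1..} t" for t
  proof (cases "0 < t")
    case True
    have e: "1 - exp (- t) \<le> t" using exp_ge_add_one_self[of "- t"] by simp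
    show ?thesis
    proof (cases "t \<le> 1")
      case le: True
      have "(1 - exp (- t)) * t powr (- q - 1) \<le> t * t powr (- q - 1)"
        using e by (intro mult_right_mono) auto
      also have "\<dots> = t powr (- q)"
        using True by (simp add: powr_mult_base)
      finally have "h 1 t \<le> ennreal (t powr (- q))"
        using True by (simp add: h_def ennreal_leI)
      then show ?thesis
        using True le by (simp add: add_increasing2)
    next
      case False
      have "(1 - exp (- t)) * t powr (- q - 1) \<le> 1 * t powr (- q - 1)"
        by (intro mult_right_mono) auto
      then show ?thesis
        using True False by (simp add: h_def ennreal_leI)
    qed
  qed (simp add: h_def)
  then have "K \<le> (\<integral>\<^sup>+t. ennreal (t powr (- q)) * indicator {0..1} t + ennreal (t powr (- q - 1)) * indicator {1..} t \<partial>lborel)"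
    unfolding K_def by (intro nn_integral_mono) auto
  also have "\<dots> = (\<integral>\<^sup>+t. ennreal (t powr (- q)) * indicator {0..1} t \<partial>lborel)
      + (\<integral>\<^sup>+t. ennreal (t powr (- q - 1)) * indicator {1..} t \<partial>lborel)"
    by (intro nn_integral_add) auto
  also have "(\<integral>\<^sup>+t. ennreal (t powr (- q)) * indicator {0..1} t \<partial>lborel) = ennreal (1 powr (- q + 1) / (- q + 1))"
    using q by (intro nn_integral_has_integral_lebesgue' has_integral_powr_from_0) auto
  also have "(\<integral>\<^sup>+t. ennreal (t powr (- q - 1)) * indicator {1..} t \<partial>lborel)
      = ennreal (- (1 powr (- q - 1 + 1)) / (- q - 1 + 1))"
    using q by (intro nn_integral_has_integral_lebesgue' has_integral_powr_to_inf) auto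
  finally have Kfin: "K < \<infinity>"
    by (rule order.strict_trans1) simp
  \<comment> \<open>A lower bound for the integrand on \<open>{1..2}\<close>: the increasing factor
    is taken at 1 and the decreasing one at 2.\<close>
  define c where "c = (1 - exp (- 1)) * 2 powr (- q - 1)"
  have c: "c > 0" by (simp add: c_def)
  have "ennreal c = (\<integral>\<^sup>+t. ennreal c * indicator {1..2::real} t \<partial>lborel)"
    by (subst nn_integral_cmult_indicator) simp_all
  also have "\<dots> \<le> K"
    unfolding K_def
  proof (intro nn_integral_mono)
    fix t :: real
    show "ennreal c * indicator {1..2} t \<le> h 1 t"
    proof (cases "t \<in> {1..2}")
      case True
      then have "c \<le> (1 - exp (- t)) * t powr (- q - 1)"
        unfolding c_def using q by (intro mult_mono powr_mono2') auto
      then show ?thesis using True by (simp add: h_def ennreal_leI)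
    qed simp
  qed
  finally have Kpos: "K > 0"
    using c by (metis ennreal_less_zero_iff order_less_le_trans)
  have "(\<integral>\<^sup>+t. h x t \<partial>lborel) = K * ennreal (x powr q)" if "x \<ge> 0" for x
  proof (cases "x = 0")
    case True
    then show ?thesis by (simp add: h_def)
  next
    case False
    with that have x: "x > 0" by simp
    have "(\<integral>\<^sup>+t. h x t \<partial>lborel) = ennreal (1 / x) * (\<integral>\<^sup>+t. h x (t / x) \<partial>lborel)"
      using x by (subst nn_integral_real_affine[where c = "1 / x" and t = 0]) auto
    also have "(\<lambda>t. h x (t / x)) = (\<lambda>t. ennreal (x powr (q + 1)) * h 1 t)"
    proof
      fix t
      show "h x (t / x) = ennreal (x powr (q + 1)) * h 1 t"
      proof (cases "0 < t")
        case True
        have "(t / x) powr (- q - 1) = t powr (- q - 1) * x powr (q + 1)"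
          using True x by (simp add: powr_divide powr_minus[of x "q + 1", simplified] field_simps)
        then show ?thesis
          using True x by (simp add: h_def ennreal_mult'[symmetric] mult_ac)
      next
        case False
        then show ?thesis using x by (simp add: h_def zero_less_divide_iff)
      qed
    qed
    also have "ennreal (1 / x) * (\<integral>\<^sup>+t. ennreal (x powr (q + 1)) * h 1 t \<partial>lborel)
        = (ennreal (1 / x) * ennreal (x powr (q + 1))) * K"
      by (subst nn_integral_cmult) (simp_all add: K_def mult_ac)
    also have "ennreal (1 / x) * ennreal (x powr (q + 1)) = ennreal (x powr q)"
      using x by (simp add: ennreal_mult'[symmetric] powr_add)
    finally show ?thesis by (simp add: mult.commute)
  qed
  with Kpos Kfin show ?thesis
    by (intro that[of K]) (simp_all add: h_def)
qed

section \<open>Sign and moments read off from Laplace transforms\<close>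

lemma AE_nonneg_if_Laplace_le_1:
  fixes X :: "'a \<Rightarrow> real"
  assumes X [measurable]: "X \<in> borel_measurable M"
    and L: "\<And>t. t \<ge> 0 \<Longrightarrow> (\<integral>\<^sup>+\<omega>. ennreal (exp (- t * X \<omega>)) \<partial>M) \<le> 1"
  shows "AE \<omega> in M. X \<omega> \<ge> 0"
proof -
  \<comment> \<open>As \<open>ennreal\<close> sends negative reals to 0, \<open>I\<close> is the
    integral of the negative part of \<open>X\<close>. From
    \<open>n * (- X) \<le> exp (- n * X)\<close> follows \<open>n * I \<le> 1\<close> for every
    \<open>n\<close>, so \<open>I = 0\<close>.\<close>
  define I where "I = (\<integral>\<^sup>+\<omega>. ennreal (- X \<omega>) \<partial>M)"
  have le: "of_nat n * I \<le> 1" for n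
  proof -
    have "of_nat n * I = (\<integral>\<^sup>+\<omega>. ennreal (real n * (- X \<omega>)) \<partial>M)"
      unfolding I_def
      by (subst nn_integral_cmult[symmetric]) (simp_all add: ennreal_of_nat_eq_real_of_nat flip: ennreal_mult')
    also have "\<dots> \<le> (\<integral>\<^sup>+\<omega>. ennreal (exp (- real n * X \<omega>)) \<partial>M)"
    proof (intro nn_integral_mono ennreal_leI)
      fix \<omega> show "real n * (- X \<omega>) \<le> exp (- real n * X \<omega>)"
        using exp_ge_add_one_self[of "- real n * X \<omega>"] by simp
    qed
    also have "\<dots> \<le> 1" by (intro L) simp
    finally show ?thesis .
  qed
  have "I = 0"
  proof (rule ccontr)
    assume "I \<noteq> 0"
    then have "(SUP n. of_nat n * I) = \<infinity>"
      by (simp add: SUP_mult_right_ennreal[symmetric] ennreal_SUP_of_nat_eq_top ennreal_top_mult)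
    moreover have "(SUP n. of_nat n * I) \<le> 1" by (intro SUP_least le)
    ultimately show False
      by (metis ennreal_one_less_top infinity_ennreal_def leD)
  qed
  then have "AE \<omega> in M. ennreal (- X \<omega>) = 0"
    unfolding I_def by (subst (asm) nn_integral_0_iff_AE) auto
  then show ?thesis
    by eventually_elim (simp add: ennreal_eq_0_iff)
qed

text \<open>The second difference at 0 cancels the constant and linear Taylor terms. The second
  derivative of \<open>poly P t powr (- \<alpha>)\<close> is bounded on \<open>{0..2}\<close>,
  because \<open>P \<ge> 1\<close> keeps the negative powers at most 1.\<close>

lemma poly_powr_second_difference:
  fixes \<alpha> :: real and P :: "real poly"
  assumes "\<alpha> > 0" and P: "\<And>t. t \<ge> 0 \<Longrightarrow> poly P t \<ge> 1" and P0: "poly P 0 = 1"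
  obtains C where "\<And>t. 0 < t \<Longrightarrow> t \<le> 1 \<Longrightarrow>
    1 - 2 * poly P t powr (- \<alpha>) + poly P (2 * t) powr (- \<alpha>) \<le> C * t\<^sup>2"
proof -
  define \<phi> where "\<phi> t = poly P t powr (- \<alpha>)" for t
  define \<phi>1 where "\<phi>1 t = - \<alpha> * poly (pderiv P) t * poly P t powr (- \<alpha> - 1)" for t
  define \<phi>2 where "\<phi>2 t = - \<alpha> * poly (pderiv (pderiv P)) t * poly P t powr (- \<alpha> - 1)
    + \<alpha> * (\<alpha> + 1) * (poly (pderiv P) t)\<^sup>2 * poly P t powr (- \<alpha> - 2)" for t
  have pos: "poly P t > 0" if "t \<ge> 0" for t using P[OF that] by simp
  have D1: "(\<phi> has_real_derivative \<phi>1 t) (at t)" if "t \<ge> 0" for t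
    unfolding \<phi>_def[abs_def] \<phi>1_def using pos[OF that]
    by (auto intro!: derivative_eq_intros simp: powr_diff field_simps)
  have D2: "(\<phi>1 has_real_derivative \<phi>2 t) (at t)" if "t \<ge> 0" for t
  proof -
    have e: "1 + (- \<alpha> - 2) = - \<alpha> - 1" by simp
    have "poly P t powr (- \<alpha> - 1) = poly P t powr (- \<alpha> - 2) * poly P t"
      using powr_mult_base[OF less_imp_le[OF pos[OF that]], of "- \<alpha> - 2", unfolded e]
      by (simp only: mult.commute)
    moreover have "- \<alpha> - 1 - 1 = - \<alpha> - 2" by simp
    ultimately show ?thesis
    unfolding \<phi>1_def[abs_def] \<phi>2_def using pos[OF that]
    by (auto intro!: derivative_eq_intros simp: field_simps power2_eq_square)
  qed
  have "continuous_on {0..2} (\<lambda>t. \<alpha> * \<bar>poly (pderiv (pderiv P)) t\<bar> + \<alpha> * (\<alpha> + 1) * (poly (pderiv P) t)\<^sup>2)"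
    by (intro continuous_intros)
  then obtain C where C: "\<And>t. t \<in> {0..2} \<Longrightarrow>
      \<alpha> * \<bar>poly (pderiv (pderiv P)) t\<bar> + \<alpha> * (\<alpha> + 1) * (poly (pderiv P) t)\<^sup>2 \<le> C"
    using compact_continuous_image[of "{0..2}"] 
    by (metis (no_types, lifting) bounded_imp_bdd_above compact_imp_bounded compact_Icc bdd_above.unfold imageI)
  have bound: "\<bar>\<phi>2 t\<bar> \<le> C" if t: "t \<in> {0..2}" for t
  proof -
    have le1: "poly P t powr (- \<alpha> - 1) \<le> 1" "poly P t powr (- \<alpha> - 2) \<le> 1"
      using P[of t] t assms(1) powr_mono[of "- \<alpha> - 1" 0 "poly P t"] powr_mono[of "- \<alpha> - 2" 0 "poly P t"]
      by auto
    have "\<bar>\<phi>2 t\<bar> \<le> \<alpha> * \<bar>poly (pderiv (pderiv P)) t\<bar> * poly P t powr (- \<alpha> - 1)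
        + \<alpha> * (\<alpha> + 1) * (poly (pderiv P) t)\<^sup>2 * poly P t powr (- \<alpha> - 2)"
      unfolding \<phi>2_def using assms(1) by (intro order_trans[OF abs_triangle_ineq]) (simp add: abs_mult)
    also have "\<dots> \<le> \<alpha> * \<bar>poly (pderiv (pderiv P)) t\<bar> * 1 + \<alpha> * (\<alpha> + 1) * (poly (pderiv P) t)\<^sup>2 * 1"
      using le1 assms(1) by (intro add_mono mult_left_mono) auto
    also have "\<dots> \<le> C" using C[OF t] by simp
    finally show ?thesis .
  qed
  have taylor: "\<bar>\<phi> h - (1 + \<phi>1 0 * h)\<bar> \<le> C * h\<^sup>2 / 2" if h: "0 < h" "h \<le> 2" for h
  proof -
    define diff where "diff m = (if m = 0 then \<phi> else if m = 1 then \<phi>1 else \<phi>2)" for m :: nat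
    have "\<forall>m t. m < 2 \<and> 0 \<le> t \<and> t \<le> h \<longrightarrow> DERIV (diff m) t :> diff (Suc m) t"
      using D1 D2 by (auto simp: diff_def less_2_cases_iff)
    then obtain t where t: "0 < t" "t < h" and eq: "\<phi> h = (\<Sum>m<2. diff m 0 / fact m * h ^ m) + diff 2 t / fact 2 * h ^ 2"
      using Maclaurin[of h 2 diff \<phi>] h by (auto simp: diff_def)
    have "\<phi> h - (1 + \<phi>1 0 * h) = \<phi>2 t / 2 * h\<^sup>2"
      unfolding eq by (simp add: diff_def numeral_2_eq_2 \<phi>_def P0)
    also have "\<bar>\<dots>\<bar> \<le> C / 2 * h\<^sup>2"
      using bound[of t] t h by (simp add: abs_mult mult_right_mono)
    finally show ?thesis by simp
  qed
  \<comment> \<open>Twice the Taylor error at \<open>t\<close> contributes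
    \<open>C * t\<^sup>2\<close> and the error at \<open>2 * t\<close> contributes
    \<open>2 * C * t\<^sup>2\<close>, hence the factor 3.\<close>
  have "1 - 2 * \<phi> t + \<phi> (2 * t) \<le> (3 * C) * t\<^sup>2" if "0 < t" "t \<le> 1" for t
  proof -
    have "1 + \<phi>1 0 * t - \<phi> t \<le> C * t\<^sup>2 / 2"
      using abs_le_D2[OF taylor[of t]] that by simp
    moreover have "\<phi> (2 * t) - (1 + \<phi>1 0 * (2 * t)) \<le> C * (2 * t)\<^sup>2 / 2"
      using abs_le_D1[OF taylor[of "2 * t"]] that by simp
    ultimately show ?thesis by (simp add: power_mult_distrib)
  qed
  then show ?thesis unfolding \<phi>_def by (rule that)
qed

text \<open>The square of \<open>1 - exp (- t * X)\<close> expands into the second difference of the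
  exponentials, so its expectation is at most \<open>C * t\<^sup>2\<close>. Dividing by
  \<open>t\<^sup>2\<close> along \<open>t = 1 / 2 ^ n\<close>, monotone convergence bounds the
  second moment by \<open>C\<close>.\<close>

lemma (in prob_space) second_moment_finite_if_Laplace_poly_powr:
  fixes X :: "'a \<Rightarrow> real" and \<alpha> :: real
  assumes X [measurable]: "X \<in> borel_measurable M" and X0: "\<And>\<omega>. X \<omega> \<ge> 0"
    and "\<alpha> > 0" and P: "\<And>t. t \<ge> 0 \<Longrightarrow> poly P t \<ge> 1" 
    and L: "\<And>t. t \<ge> 0 \<Longrightarrow> expectation (\<lambda>\<omega>. exp (- t * X \<omega>)) = poly P t powr (- \<alpha>)"
  shows "integrable M (\<lambda>\<omega>. (X \<omega>)\<^sup>2)"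
proof -
  have int: "integrable M (\<lambda>\<omega>. exp (- t * X \<omega>))" if "t \<ge> 0" for t
    using X0 that by (intro integrable_const_bound[where B = 1]) (auto simp: mult_nonneg_nonneg)
  have "poly P 0 powr (- \<alpha>) = 1"
    using L[of 0] prob_space by simp
  then have P0: "poly P 0 = 1"
    using powr_eq_one_iff_gen[of "poly P 0" "- \<alpha>"] P[of 0] assms(3) by fastforce
  obtain C where C: "\<And>t. 0 < t \<Longrightarrow> t \<le> 1 \<Longrightarrow>
    1 - 2 * poly P t powr (- \<alpha>) + poly P (2 * t) powr (- \<alpha>) \<le> C * t\<^sup>2"
    using poly_powr_second_difference[OF assms(3) P P0] by blast
  have le: "(\<integral>\<^sup>+\<omega>. ennreal ((exp_quotient n (X \<omega>))\<^sup>2) \<partial>M) \<le> ennreal C" for n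
  proof -
    define t :: real where "t = 1 / 2 ^ n"
    have t: "0 < t" "t \<le> 1" by (auto simp: t_def)
    have exp_quotient: "(exp_quotient n (X \<omega>))\<^sup>2 = (1 - 2 * exp (- t * X \<omega>) + exp (- (2 * t) * X \<omega>)) / t\<^sup>2" for \<omega>
    proof -
      have "exp (- (2 * t) * X \<omega>) = (exp (- t * X \<omega>))\<^sup>2"
        by (simp add: exp_double[symmetric])
      moreover have "exp_quotient n (X \<omega>) = (1 - exp (- t * X \<omega>)) / t"
        by (simp add: exp_quotient_def t_def)
      ultimately show ?thesis by (simp add: power_divide power2_diff)
    qed
    have i: "integrable M (\<lambda>\<omega>. (1 - 2 * exp (- t * X \<omega>) + exp (- (2 * t) * X \<omega>)) / t\<^sup>2)"
      using int[of t] int[of "2 * t"] t by simp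
    have "(\<integral>\<^sup>+\<omega>. ennreal ((exp_quotient n (X \<omega>))\<^sup>2) \<partial>M) = ennreal (expectation (\<lambda>\<omega>. (exp_quotient n (X \<omega>))\<^sup>2))"
      using i unfolding exp_quotient[symmetric] by (intro nn_integral_eq_integral) auto
    also have "expectation (\<lambda>\<omega>. (exp_quotient n (X \<omega>))\<^sup>2) = (1 - 2 * poly P t powr (- \<alpha>) + poly P (2 * t) powr (- \<alpha>)) / t\<^sup>2"
      unfolding exp_quotient using int[of t] int[of "2 * t"] t L[of t] L[of "2 * t"] by (simp add: prob_space)
    also have "\<dots> \<le> C"
      using C[OF t] t by (simp add: pos_divide_le_eq)
    finally show ?thesis by (simp add: ennreal_leI)
  qed
  have "(\<integral>\<^sup>+\<omega>. ennreal ((X \<omega>)\<^sup>2) \<partial>M) = (\<integral>\<^sup>+\<omega>. (SUP n. ennreal ((exp_quotient n (X \<omega>))\<^sup>2)) \<partial>M)"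
    by (simp add: SUP_ennreal_exp_quotient_sq X0)
  also have "\<dots> = (SUP n. (\<integral>\<^sup>+\<omega>. ennreal ((exp_quotient n (X \<omega>))\<^sup>2) \<partial>M))"
    by (intro nn_integral_monotone_convergence_SUP incseq_SucI le_funI ennreal_leI power_mono exp_quotient_mono exp_quotient_nonneg X0)
       (simp add: exp_quotient_def)
  also have "\<dots> \<le> ennreal C" by (intro SUP_least le)
  finally have "(\<integral>\<^sup>+\<omega>. ennreal ((X \<omega>)\<^sup>2) \<partial>M) < \<infinity>"
    by (rule order.strict_trans1) simp
  then show ?thesis
    by (intro integrableI_bounded) auto
qed

text \<open>The factor \<open>G\<close> stays arbitrary so that the lemma can be applied once per
  variable: first with an exponential in the other variable as \<open>G\<close>, then with a power
  of it. Values in \<open>ennreal\<close> postpone all integrability questions.\<close>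

lemma (in prob_space) nn_integral_powr_mult_ge:
  fixes X :: "'a \<Rightarrow> real" and G :: "'a \<Rightarrow> ennreal"
  assumes X [measurable]: "X \<in> borel_measurable M" and X0: "\<And>\<omega>. X \<omega> \<ge> 0"
    and G [measurable]: "G \<in> borel_measurable M"
    and le: "\<And>t. t > 0 \<Longrightarrow> (\<integral>\<^sup>+\<omega>. ennreal (1 - exp (- t * X \<omega>)) \<partial>M) * (\<integral>\<^sup>+\<omega>. G \<omega> \<partial>M)
        \<le> (\<integral>\<^sup>+\<omega>. ennreal (1 - exp (- t * X \<omega>)) * G \<omega> \<partial>M)"
    and q: "0 < q" "q \<le> 1"
  shows "(\<integral>\<^sup>+\<omega>. ennreal (X \<omega> powr q) \<partial>M) * (\<integral>\<^sup>+\<omega>. G \<omega> \<partial>M)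
    \<le> (\<integral>\<^sup>+\<omega>. ennreal (X \<omega> powr q) * G \<omega> \<partial>M)"
proof (cases "q = 1")
  \<comment> \<open>For \<open>q = 1\<close> the mixture integral diverges at 0, so the dyadic
    difference quotients, which increase to \<open>X\<close>, replace it.\<close>
  case True
  define E where "E = (\<integral>\<^sup>+\<omega>. G \<omega> \<partial>M)"
  have "(\<integral>\<^sup>+\<omega>. ennreal (X \<omega> powr q) \<partial>M) = (\<integral>\<^sup>+\<omega>. (SUP n. ennreal (exp_quotient n (X \<omega>))) \<partial>M)"
    using X0 True by (simp add: SUP_ennreal_exp_quotient)
  also have "\<dots> = (SUP n. (\<integral>\<^sup>+\<omega>. ennreal (exp_quotient n (X \<omega>)) \<partial>M))"
    by (intro nn_integral_monotone_convergence_SUP incseq_SucI le_funI ennreal_leI exp_quotient_mono)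
       (simp add: exp_quotient_def)
  also have "\<dots> * E = (SUP n. (\<integral>\<^sup>+\<omega>. ennreal (exp_quotient n (X \<omega>)) \<partial>M) * E)"
    by (rule SUP_mult_right_ennreal)
  also have "\<dots> \<le> (\<integral>\<^sup>+\<omega>. ennreal (X \<omega> powr q) * G \<omega> \<partial>M)"
  proof (intro SUP_least)
    fix n :: nat
    define t :: real where "t = 1 / 2 ^ n"
    have exp_quotient: "ennreal (exp_quotient n (X \<omega>)) = ennreal (2 ^ n) * ennreal (1 - exp (- t * X \<omega>))" for \<omega>
      by (simp add: exp_quotient_def t_def ennreal_mult')
    have "(\<integral>\<^sup>+\<omega>. ennreal (exp_quotient n (X \<omega>)) \<partial>M) * E
        = ennreal (2 ^ n) * ((\<integral>\<^sup>+\<omega>. ennreal (1 - exp (- t * X \<omega>)) \<partial>M) * E)"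
      unfolding exp_quotient by (subst nn_integral_cmult) (simp_all add: mult.assoc)
    also have "\<dots> \<le> ennreal (2 ^ n) * (\<integral>\<^sup>+\<omega>. ennreal (1 - exp (- t * X \<omega>)) * G \<omega> \<partial>M)"
      unfolding E_def by (intro mult_left_mono le) (auto simp: t_def)
    also have "\<dots> = (\<integral>\<^sup>+\<omega>. ennreal (exp_quotient n (X \<omega>)) * G \<omega> \<partial>M)"
      unfolding exp_quotient by (subst nn_integral_cmult[symmetric]) (simp_all add: mult.assoc)
    also have "\<dots> \<le> (\<integral>\<^sup>+\<omega>. ennreal (X \<omega> powr q) * G \<omega> \<partial>M)"
      using X0 True by (intro nn_integral_mono mult_right_mono ennreal_leI) (auto simp: exp_quotient_le)
    finally show "(\<integral>\<^sup>+\<omega>. ennreal (exp_quotient n (X \<omega>)) \<partial>M) * E \<le> (\<integral>\<^sup>+\<omega>. ennreal (X \<omega> powr q) * G \<omega> \<partial>M)" .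
  qed
  finally show ?thesis unfolding E_def .
next
  case False
  with q have "q < 1" by simp
  then obtain K :: ennreal where K: "0 < K" "K < \<infinity>"
    and KX: "\<And>x. x \<ge> 0 \<Longrightarrow>
      (\<integral>\<^sup>+t. ennreal ((1 - exp (- t * x)) * t powr (- q - 1)) * indicator {0<..} t \<partial>lborel) = K * ennreal (x powr q)"
    using nn_integral_one_minus_exp_powr[OF q(1)] by blast
  define w where "w t = ennreal (t powr (- q - 1)) * indicator {0<..} t" for t :: real
  have [measurable]: "w \<in> borel_measurable borel" unfolding w_def[abs_def] by measurable
  \<comment> \<open>Tonelli exchanges the mixture over \<open>t\<close> with the expectation; used
    for \<open>H = 1\<close> and for \<open>H = G\<close>.\<close>
  have mix: "K * (\<integral>\<^sup>+\<omega>. ennreal (X \<omega> powr q) * H \<omega> \<partial>M)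
      = (\<integral>\<^sup>+t. w t * (\<integral>\<^sup>+\<omega>. ennreal (1 - exp (- t * X \<omega>)) * H \<omega> \<partial>M) \<partial>lborel)"
    if [measurable]: "H \<in> borel_measurable M" for H
  proof -
    interpret pair_sigma_finite lborel M
      by unfold_locales
    have "K * (\<integral>\<^sup>+\<omega>. ennreal (X \<omega> powr q) * H \<omega> \<partial>M) = (\<integral>\<^sup>+\<omega>. (K * ennreal (X \<omega> powr q)) * H \<omega> \<partial>M)"
      by (subst nn_integral_cmult[symmetric]) (simp_all add: mult.assoc)
    also have "\<dots> = (\<integral>\<^sup>+\<omega>. (\<integral>\<^sup>+t. w t * (ennreal (1 - exp (- t * X \<omega>)) * H \<omega>) \<partial>lborel) \<partial>M)"
    proof (intro nn_integral_cong)
      fix \<omega>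
      have "(K * ennreal (X \<omega> powr q)) * H \<omega>
          = (\<integral>\<^sup>+t. (ennreal ((1 - exp (- t * X \<omega>)) * t powr (- q - 1)) * indicator {0<..} t) * H \<omega> \<partial>lborel)"
        unfolding KX[OF X0, symmetric] by (rule nn_integral_multc[symmetric]) auto
      also have "\<dots> = (\<integral>\<^sup>+t. w t * (ennreal (1 - exp (- t * X \<omega>)) * H \<omega>) \<partial>lborel)"
        by (intro nn_integral_cong) (auto simp: w_def ennreal_mult' mult_ac split: split_indicator)
      finally show "(K * ennreal (X \<omega> powr q)) * H \<omega> = (\<integral>\<^sup>+t. w t * (ennreal (1 - exp (- t * X \<omega>)) * H \<omega>) \<partial>lborel)" .
    qed
    also have "\<dots> = (\<integral>\<^sup>+t. (\<integral>\<^sup>+\<omega>. w t * (ennreal (1 - exp (- t * X \<omega>)) * H \<omega>) \<partial>M) \<partial>lborel)"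
      by (rule Fubini') measurable
    also have "\<dots> = (\<integral>\<^sup>+t. w t * (\<integral>\<^sup>+\<omega>. ennreal (1 - exp (- t * X \<omega>)) * H \<omega> \<partial>M) \<partial>lborel)"
      by (intro nn_integral_cong nn_integral_cmult) auto
    finally show ?thesis .
  qed
  define E where "E = (\<integral>\<^sup>+\<omega>. G \<omega> \<partial>M)"
  have "K * ((\<integral>\<^sup>+\<omega>. ennreal (X \<omega> powr q) \<partial>M) * E)
      = (\<integral>\<^sup>+t. w t * (\<integral>\<^sup>+\<omega>. ennreal (1 - exp (- t * X \<omega>)) \<partial>M) \<partial>lborel) * E"
    using mix[of "\<lambda>_. 1"] by (simp add: mult.assoc[symmetric])
  also have "\<dots> = (\<integral>\<^sup>+t. w t * (\<integral>\<^sup>+\<omega>. ennreal (1 - exp (- t * X \<omega>)) \<partial>M) * E \<partial>lborel)"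
    by (rule nn_integral_multc[symmetric]) measurable
  also have "\<dots> \<le> (\<integral>\<^sup>+t. w t * (\<integral>\<^sup>+\<omega>. ennreal (1 - exp (- t * X \<omega>)) * G \<omega> \<partial>M) \<partial>lborel)"
  proof (intro nn_integral_mono)
    fix t :: real
    show "w t * (\<integral>\<^sup>+\<omega>. ennreal (1 - exp (- t * X \<omega>)) \<partial>M) * E
        \<le> w t * (\<integral>\<^sup>+\<omega>. ennreal (1 - exp (- t * X \<omega>)) * G \<omega> \<partial>M)"
    proof (cases "t > 0")
      case True
      then show ?thesis
        unfolding mult.assoc E_def by (intro mult_left_mono le) auto
    qed (simp add: w_def)
  qed
  also have "\<dots> = K * (\<integral>\<^sup>+\<omega>. ennreal (X \<omega> powr q) * G \<omega> \<partial>M)"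
    by (rule mix[symmetric]) measurable
  finally show ?thesis
    using K unfolding E_def by (subst (asm) ennreal_mult_le_mult_iff) auto
qed

subsection \<open>Association of fractional moments\<close>

lemma (in prob_space) expectation_rpow_mult_ge:
  fixes X Y :: "'a \<Rightarrow> real"
  assumes [measurable]: "X \<in> borel_measurable M" "Y \<in> borel_measurable M"
    and X0: "\<And>\<omega>. X \<omega> \<ge> 0" and Y0: "\<And>\<omega>. Y \<omega> \<ge> 0"
    and X2: "integrable M (\<lambda>\<omega>. (X \<omega>)\<^sup>2)" and Y2: "integrable M (\<lambda>\<omega>. (Y \<omega>)\<^sup>2)"
    and L: "\<And>s t. s > 0 \<Longrightarrow> t > 0 \<Longrightarrow>
      expectation (\<lambda>\<omega>. exp (- s * X \<omega>)) * expectation (\<lambda>\<omega>. exp (- t * Y \<omega>))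
        \<le> expectation (\<lambda>\<omega>. exp (- s * X \<omega> - t * Y \<omega>))"
    and q: "q1 \<in> {0..1}" "q2 \<in> {0..1}"
  shows "expectation (\<lambda>\<omega>. rpow (X \<omega>) q1) * expectation (\<lambda>\<omega>. rpow (Y \<omega>) q2)
    \<le> expectation (\<lambda>\<omega>. rpow (X \<omega>) q1 * rpow (Y \<omega>) q2)"
proof (cases "q1 = 0 \<or> q2 = 0")
  \<comment> \<open>An exponent 0 makes one factor the constant 1, and both sides agree.\<close>
  case True
  then show ?thesis by (auto simp: rpow_def prob_space)
next
  case False
  with q have q1: "0 < q1" "q1 \<le> 1" and q2: "0 < q2" "q2 \<le> 1" by auto
  have one_minus_exp_nonneg: "1 - exp (- t * x) \<ge> 0" if "t > 0" "x \<ge> 0" for t x :: real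
    using that by simp
  have int_exp: "integrable M (\<lambda>\<omega>. exp (- s * X \<omega>))" "integrable M (\<lambda>\<omega>. exp (- t * Y \<omega>))"
    "integrable M (\<lambda>\<omega>. exp (- s * X \<omega> - t * Y \<omega>))" if "s > 0" "t > 0" for s t
  proof -
    have "- (s * X \<omega>) \<le> t * Y \<omega>" for \<omega>
      using mult_nonneg_nonneg[OF _ X0, of s \<omega>] mult_nonneg_nonneg[OF _ Y0, of t \<omega>] that by linarith
    then show "integrable M (\<lambda>\<omega>. exp (- s * X \<omega>))" "integrable M (\<lambda>\<omega>. exp (- t * Y \<omega>))"
      "integrable M (\<lambda>\<omega>. exp (- s * X \<omega> - t * Y \<omega>))"
      using that X0 Y0 by (auto intro!: integrable_const_bound[where B = 1])
  qed
  \<comment> \<open>After expanding the product, the covariance of \<open>1 - exp (- s * X)\<close>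
    and \<open>1 - exp (- t * Y)\<close> is that of the exponentials themselves, which
    \<open>L\<close> makes nonnegative.\<close>
  have exp_le: "(\<integral>\<^sup>+\<omega>. ennreal (1 - exp (- s * X \<omega>)) \<partial>M) * (\<integral>\<^sup>+\<omega>. ennreal (1 - exp (- t * Y \<omega>)) \<partial>M)
      \<le> (\<integral>\<^sup>+\<omega>. ennreal (1 - exp (- s * X \<omega>)) * ennreal (1 - exp (- t * Y \<omega>)) \<partial>M)"
    if s: "s > 0" and t: "t > 0" for s t
  proof -
    note i = int_exp[OF s t]
    have prod: "(1 - exp (- s * X \<omega>)) * (1 - exp (- t * Y \<omega>))
        = 1 - exp (- s * X \<omega>) - exp (- t * Y \<omega>) + exp (- s * X \<omega> - t * Y \<omega>)" for \<omega>
      by (simp add: exp_diff exp_minus field_simps)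
    have "(\<integral>\<^sup>+\<omega>. ennreal (1 - exp (- s * X \<omega>)) \<partial>M) * (\<integral>\<^sup>+\<omega>. ennreal (1 - exp (- t * Y \<omega>)) \<partial>M)
        = ennreal (expectation (\<lambda>\<omega>. 1 - exp (- s * X \<omega>))) * ennreal (expectation (\<lambda>\<omega>. 1 - exp (- t * Y \<omega>)))"
      using i s t X0 Y0 by (intro arg_cong2[where f = "(*)"] nn_integral_eq_integral AE_I2 one_minus_exp_nonneg) auto
    also have "\<dots> = ennreal (expectation (\<lambda>\<omega>. 1 - exp (- s * X \<omega>)) * expectation (\<lambda>\<omega>. 1 - exp (- t * Y \<omega>)))"
      using s t X0 Y0 by (intro ennreal_mult[symmetric] Bochner_Integration.integral_nonneg one_minus_exp_nonneg)
    also have "\<dots> \<le> ennreal (expectation (\<lambda>\<omega>. (1 - exp (- s * X \<omega>)) * (1 - exp (- t * Y \<omega>))))"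
      unfolding prod using i L[OF s t] by (intro ennreal_leI) (simp add: prob_space algebra_simps)
    also have "\<dots> = (\<integral>\<^sup>+\<omega>. ennreal ((1 - exp (- s * X \<omega>)) * (1 - exp (- t * Y \<omega>))) \<partial>M)"
    proof (rule nn_integral_eq_integral[symmetric])
      show "integrable M (\<lambda>\<omega>. (1 - exp (- s * X \<omega>)) * (1 - exp (- t * Y \<omega>)))"
        unfolding prod using i by simp
    qed (use s t X0 Y0 in \<open>intro AE_I2 mult_nonneg_nonneg one_minus_exp_nonneg\<close>)
    also have "\<dots> = (\<integral>\<^sup>+\<omega>. ennreal (1 - exp (- s * X \<omega>)) * ennreal (1 - exp (- t * Y \<omega>)) \<partial>M)"
      using s t X0 Y0 by (intro nn_integral_cong ennreal_mult one_minus_exp_nonneg)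
    finally show ?thesis .
  qed
  \<comment> \<open>First the exponential in \<open>X\<close> becomes a power, with the one in
    \<open>Y\<close> as the fixed factor; then \<open>full\<close> does the same for
    \<open>Y\<close> against that power.\<close>
  have half: "(\<integral>\<^sup>+\<omega>. ennreal (X \<omega> powr q1) \<partial>M) * (\<integral>\<^sup>+\<omega>. ennreal (1 - exp (- t * Y \<omega>)) \<partial>M)
      \<le> (\<integral>\<^sup>+\<omega>. ennreal (X \<omega> powr q1) * ennreal (1 - exp (- t * Y \<omega>)) \<partial>M)" if "t > 0" for t
    by (rule nn_integral_powr_mult_ge[OF _ X0 _ exp_le[OF _ that] q1]) simp_all
  have full: "(\<integral>\<^sup>+\<omega>. ennreal (Y \<omega> powr q2) \<partial>M) * (\<integral>\<^sup>+\<omega>. ennreal (X \<omega> powr q1) \<partial>M)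
      \<le> (\<integral>\<^sup>+\<omega>. ennreal (Y \<omega> powr q2) * ennreal (X \<omega> powr q1) \<partial>M)"
    by (rule nn_integral_powr_mult_ge[OF _ Y0 _ _ q2]) (use half in \<open>simp_all add: mult.commute\<close>)
  have powr_le: "x powr r \<le> 1 + x" if "x \<ge> 0" "0 < r" "r \<le> 1" for x r :: real
  proof (cases "x \<le> 1")
    case True
    then have "x powr r \<le> 1" using that by (intro powr_le1) auto
    then show ?thesis using that by simp
  next
    case False
    then have "x powr r \<le> x powr 1" using that by (intro powr_mono) auto
    then show ?thesis using that by simp
  qed
  have le2: "(1 + x) * (1 + y) \<le> 2 + x\<^sup>2 + (y\<^sup>2 :: real)" for x y
    using zero_le_power2[of "x - y"] zero_le_power2[of "x - 1"] zero_le_power2[of "y - 1"]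
    by (simp add: power2_eq_square algebra_simps)
  have iB: "integrable M (\<lambda>\<omega>. 2 + (X \<omega>)\<^sup>2 + (Y \<omega>)\<^sup>2)"
    using X2 Y2 by simp
  have iX: "integrable M (\<lambda>\<omega>. X \<omega> powr q1)"
  proof (rule Bochner_Integration.integrable_bound[OF iB])
    have "X \<omega> powr q1 \<le> 2 + (X \<omega>)\<^sup>2 + (Y \<omega>)\<^sup>2" for \<omega>
      using powr_le[OF X0 q1, of \<omega>] le2[of "X \<omega>" 0, simplified] zero_le_power2[of "Y \<omega>"] by linarith
    then show "AE \<omega> in M. norm (X \<omega> powr q1) \<le> norm (2 + (X \<omega>)\<^sup>2 + (Y \<omega>)\<^sup>2)" by simp
  qed simp
  have iY: "integrable M (\<lambda>\<omega>. Y \<omega> powr q2)"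
  proof (rule Bochner_Integration.integrable_bound[OF iB])
    have "Y \<omega> powr q2 \<le> 2 + (X \<omega>)\<^sup>2 + (Y \<omega>)\<^sup>2" for \<omega>
      using powr_le[OF Y0 q2, of \<omega>] le2[of 0 "Y \<omega>", simplified] zero_le_power2[of "X \<omega>"] by linarith
    then show "AE \<omega> in M. norm (Y \<omega> powr q2) \<le> norm (2 + (X \<omega>)\<^sup>2 + (Y \<omega>)\<^sup>2)" by simp
  qed simp
  have iXY: "integrable M (\<lambda>\<omega>. X \<omega> powr q1 * Y \<omega> powr q2)"
  proof (rule Bochner_Integration.integrable_bound[OF iB])
    have "X \<omega> powr q1 * Y \<omega> powr q2 \<le> 2 + (X \<omega>)\<^sup>2 + (Y \<omega>)\<^sup>2" for \<omega>
    proof -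
      have "X \<omega> powr q1 * Y \<omega> powr q2 \<le> (1 + X \<omega>) * (1 + Y \<omega>)"
        using powr_le[OF X0 q1] powr_le[OF Y0 q2] X0[of \<omega>] by (intro mult_mono) auto
      also note le2
      finally show ?thesis .
    qed
    then show "AE \<omega> in M. norm (X \<omega> powr q1 * Y \<omega> powr q2) \<le> norm (2 + (X \<omega>)\<^sup>2 + (Y \<omega>)\<^sup>2)"
      by (simp add: abs_mult)
  qed simp
  have "ennreal (expectation (\<lambda>\<omega>. X \<omega> powr q1) * expectation (\<lambda>\<omega>. Y \<omega> powr q2))
      = (\<integral>\<^sup>+\<omega>. ennreal (X \<omega> powr q1) \<partial>M) * (\<integral>\<^sup>+\<omega>. ennreal (Y \<omega> powr q2) \<partial>M)"
    using iX iY by (simp add: nn_integral_eq_integral ennreal_mult' integral_nonneg)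
  also have "\<dots> \<le> (\<integral>\<^sup>+\<omega>. ennreal (X \<omega> powr q1 * Y \<omega> powr q2) \<partial>M)"
    using full by (simp add: ennreal_mult' mult.commute)
  also have "\<dots> = ennreal (expectation (\<lambda>\<omega>. X \<omega> powr q1 * Y \<omega> powr q2))"
    using iXY by (intro nn_integral_eq_integral) auto
  finally show ?thesis
    using False by (simp add: rpow_def integral_nonneg ennreal_le_iff)
qed

theorem corollary2:
  fixes M :: "'a measure" and p1 p2 :: nat and \<alpha> q1 q2 :: real
    and \<Sigma> :: "real mat" and X1 X2 :: "'a \<Rightarrow> real"
  assumes "prob_space M"
    and "p1 \<ge> 1" and "p2 \<ge> 1"
    and "2 * \<alpha> \<in> real ` {1..} \<union> {real (p1 + p2) - 1 <..}"
    and "sym_pos_semidef (p1 + p2) \<Sigma>"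
    and "trace_Wishart2 M p1 p2 \<alpha> \<Sigma> X1 X2"
    and "q1 \<in> {0..1}" and "q2 \<in> {0..1}"
  shows "prob_space.expectation M (\<lambda>\<omega>. rpow (X1 \<omega>) q1 * rpow (X2 \<omega>) q2)
       \<ge> prob_space.expectation M (\<lambda>\<omega>. rpow (X1 \<omega>) q1) *
         prob_space.expectation M (\<lambda>\<omega>. rpow (X2 \<omega>) q2)"
proof -
  interpret prob_space M by fact
  \<comment> \<open>Either \<open>2 * \<alpha>\<close> is a positive integer or it exceeds
    \<open>p1 + p2 - 1 \<ge> 1\<close>.\<close>
  have \<alpha>: "\<alpha> > 0" using assms(2-4) by auto
  have X [measurable]: "X1 \<in> borel_measurable M" "X2 \<in> borel_measurable M"
    using assms(6) by (auto simp: trace_Wishart2_def)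
  define L where "L t1 t2 = det (1\<^sub>m (p1 + p2) + diag_block_mat [t1 \<cdot>\<^sub>m 1\<^sub>m p1, t2 \<cdot>\<^sub>m 1\<^sub>m p2] * \<Sigma>)" for t1 t2
  have HB: "has_bochner_integral M (\<lambda>\<omega>. exp (- t1 * X1 \<omega> - t2 * X2 \<omega>)) (L t1 t2 powr (- \<alpha>))"
    if "t1 \<ge> 0" "t2 \<ge> 0" for t1 t2
    using assms(6) that unfolding trace_Wishart2_def L_def by blast
  have L_left: "L t 0 \<ge> 1" and L_right: "L 0 t \<ge> 1" if "t \<ge> 0" for t
    unfolding L_def using that det_TW_left_ge_1[OF assms(5)] det_TW_right_ge_1[OF assms(5)] by blast+
  obtain P where P: "\<And>t. t \<ge> 0 \<Longrightarrow> poly P t \<ge> 1" and LP: "\<And>t. L t t = poly P t"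
    using det_TW_diag_poly[OF assms(5)] unfolding L_def by blast
  have powr_le: "x powr (- \<alpha>) \<le> 1" if "x \<ge> 1" for x
    using powr_mono[of "- \<alpha>" 0 x] that \<alpha> by auto
  have nn: "(\<integral>\<^sup>+\<omega>. ennreal (exp (- t1 * X1 \<omega> - t2 * X2 \<omega>)) \<partial>M) = ennreal (L t1 t2 powr (- \<alpha>))"
    if "t1 \<ge> 0" "t2 \<ge> 0" for t1 t2
    using HB[OF that] by (subst nn_integral_eq_integral) (auto simp: has_bochner_integral_iff)
  have "AE \<omega> in M. X1 \<omega> \<ge> 0"
  proof (rule AE_nonneg_if_Laplace_le_1[OF X(1)])
    fix t :: real assume "t \<ge> 0"
    then show "(\<integral>\<^sup>+\<omega>. ennreal (exp (- t * X1 \<omega>)) \<partial>M) \<le> 1"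
      using nn[of t 0] powr_le[OF L_left] by simp
  qed
  moreover have "AE \<omega> in M. X2 \<omega> \<ge> 0"
  proof (rule AE_nonneg_if_Laplace_le_1[OF X(2)])
    fix t :: real assume "t \<ge> 0"
    then show "(\<integral>\<^sup>+\<omega>. ennreal (exp (- t * X2 \<omega>)) \<partial>M) \<le> 1"
      using nn[of 0 t] powr_le[OF L_right] by simp
  qed
  ultimately have AE: "AE \<omega> in M. X1 \<omega> = max (X1 \<omega>) 0 \<and> X2 \<omega> = max (X2 \<omega>) 0"
    by eventually_elim simp
  \<comment> \<open>Truncation at 0 gives versions that are nonnegative everywhere, as the preceding
    lemmas require, and have the same expectations.\<close>
  define Y1 where "Y1 \<omega> = max (X1 \<omega>) 0" for \<omega>
  define Y2 where "Y2 \<omega> = max (X2 \<omega>) 0" for \<omega>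
  have Y [measurable]: "Y1 \<in> borel_measurable M" "Y2 \<in> borel_measurable M"
    unfolding Y1_def[abs_def] Y2_def[abs_def] by measurable
  have Y0: "Y1 \<omega> \<ge> 0" "Y2 \<omega> \<ge> 0" for \<omega>
    by (simp_all add: Y1_def Y2_def)
  have E_eq: "expectation (\<lambda>\<omega>. h (X1 \<omega>) (X2 \<omega>)) = expectation (\<lambda>\<omega>. h (Y1 \<omega>) (Y2 \<omega>))"
    if "case_prod h \<in> borel_measurable (borel \<Otimes>\<^sub>M borel)" for h :: "real \<Rightarrow> real \<Rightarrow> real"
  proof (rule integral_cong_AE)
    show "AE \<omega> in M. h (X1 \<omega>) (X2 \<omega>) = h (Y1 \<omega>) (Y2 \<omega>)"
      using AE by eventually_elim (simp add: Y1_def Y2_def)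
  qed (use measurable_compose[OF measurable_Pair[OF X] that]
      measurable_compose[OF measurable_Pair[OF Y] that] in simp_all)
  have rpow [measurable]: "(\<lambda>x. rpow x q) \<in> borel_measurable borel" for q
    by (cases "q = 0") (simp_all add: rpow_def)
  have Laplace: "expectation (\<lambda>\<omega>. exp (- t1 * Y1 \<omega> - t2 * Y2 \<omega>)) = L t1 t2 powr (- \<alpha>)"
    if "t1 \<ge> 0" "t2 \<ge> 0" for t1 t2
    using HB[OF that] E_eq[of "\<lambda>x y. exp (- t1 * x - t2 * y)"]
    by (simp add: has_bochner_integral_iff)
  \<comment> \<open>The transform of the sum is the diagonal case, a negative power of a polynomial.
    By nonnegativity the square of the sum dominates both individual squares.\<close>
  have S2: "integrable M (\<lambda>\<omega>. (Y1 \<omega> + Y2 \<omega>)\<^sup>2)"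
  proof (rule second_moment_finite_if_Laplace_poly_powr[OF _ _ \<alpha> P])
    show "expectation (\<lambda>\<omega>. exp (- t * (Y1 \<omega> + Y2 \<omega>))) = poly P t powr (- \<alpha>)" if "t \<ge> 0" for t
      using Laplace[OF that that] by (simp add: LP algebra_simps)
  qed (use Y0 in auto)
  have "expectation (\<lambda>\<omega>. rpow (Y1 \<omega>) q1) * expectation (\<lambda>\<omega>. rpow (Y2 \<omega>) q2)
      \<le> expectation (\<lambda>\<omega>. rpow (Y1 \<omega>) q1 * rpow (Y2 \<omega>) q2)"
  proof (rule expectation_rpow_mult_ge[OF Y Y0 _ _ _ assms(7,8)])
    show "integrable M (\<lambda>\<omega>. (Y1 \<omega>)\<^sup>2)"
      by (rule Bochner_Integration.integrable_bound[OF S2]) (use Y0 in \<open>auto intro!: power_mono\<close>)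
    show "integrable M (\<lambda>\<omega>. (Y2 \<omega>)\<^sup>2)"
      by (rule Bochner_Integration.integrable_bound[OF S2]) (use Y0 in \<open>auto intro!: power_mono\<close>)
    fix s t :: real assume st: "s > 0" "t > 0"
    have pos: "L s t > 0" and le: "L s t \<le> L s 0 * L 0 t"
      unfolding L_def using det_TW_pos_Fischer[OF assms(5) st] by blast+
    have "expectation (\<lambda>\<omega>. exp (- s * Y1 \<omega>)) * expectation (\<lambda>\<omega>. exp (- t * Y2 \<omega>))
        = L s 0 powr (- \<alpha>) * L 0 t powr (- \<alpha>)"
      using Laplace[of s 0] Laplace[of 0 t] st by simp
    also have "\<dots> = (L s 0 * L 0 t) powr (- \<alpha>)"
      using L_left[of s] L_right[of t] st by (intro powr_mult[symmetric])
    \<comment> \<open>The exponent \<open>- \<alpha>\<close> is negative, so Fischer's upper bound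
      on the determinant becomes a lower bound on the joint transform.\<close>
    also have "\<dots> \<le> L s t powr (- \<alpha>)"
      using \<alpha> pos le by (intro powr_mono2') auto
    also have "\<dots> = expectation (\<lambda>\<omega>. exp (- s * Y1 \<omega> - t * Y2 \<omega>))"
      using Laplace[of s t] st by simp
    finally show "expectation (\<lambda>\<omega>. exp (- s * Y1 \<omega>)) * expectation (\<lambda>\<omega>. exp (- t * Y2 \<omega>))
        \<le> expectation (\<lambda>\<omega>. exp (- s * Y1 \<omega> - t * Y2 \<omega>))" .
  qed
  then show ?thesis
    using E_eq[of "\<lambda>x y. rpow x q1"] E_eq[of "\<lambda>x y. rpow y q2"] E_eq[of "\<lambda>x y. rpow x q1 * rpow y q2"]
    by simp
qed

end
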